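(* Let $n\ge1$ be an integer and define $\langle f,g\rangle_{\triangle^\circ,n}=\frac6{n^3}\sum_{\mathbf j\in\Lambda_n^\circ}f(\tfrac{\mathbf j}{4n})\overline{g(\tfrac{\mathbf j}{4n})}$. Then $$\langle f,g\rangle_{\triangle^\circ,n}=\langle f,g\rangle_{\triangle_H}\qquad\text{for all } f,g\in\mathcal{TS}_n .$$
   Context: Let $\mathbb R^4_H=\{\mathbf t\in\mathbb R^4: t_1+t_2+t_3+t_4=0\}$ with 3-dimensional Lebesgue measure $d\mathbf t$, $\mathbb Z^4_H=\mathbb Z^4\cap\mathbb R^4_H$, $\mathbb H=\{\mathbf k\in\mathbb Z^4_H: k_1\equiv k_2\equiv k_3\equiv k_4\pmod4\}$, $\phi_{\mathbf k}(\mathbf t)=e^{\frac{\pi i}{2}\mathbf k\cdot\mathbf t}$. Let $\mathcal G=S_4$ act on $\mathbf t$ by permuting coordinates, $\mathbf t\mapsto\mathbf t\sigma$, and let $\operatorname{sgn}\sigma$ be the sign of $\sigma$. Define $\mathsf{TS}_{\mathbf k}(\mathbf t)=-\frac1{24}\sum_{\sigma\in\mathcal G}\operatorname{sgn}(\sigma)\phi_{\mathbf k}(\mathbf t\sigma)$. Let $\triangle_H=\{\mathbf t\in\mathbb R^4_H: t_1-t_2,\,t_2-t_3,\,t_3-t_4,\,t_1-t_4\in[0,1]\}$ and $\langle f,g\rangle_{\triangle_H}=\frac1{|\triangle_H|}\int_{\triangle_H}f\bar g\,d\mathbf t$. Let $\Lambda_n^\circ=\{\mathbf k\in\mathbb H: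 k_4<k_3<k_2<k_1<k_4+4n\}$ and $\mathcal{TS}_n=\operatorname{span}\{\mathsf{TS}_{\mathbf k}:\mathbf k\in\Lambda_n^\circ\}$. *)

theory Defs
  imports "HOL-Analysis.Analysis"
begin

definition phi :: "int^4 \<Rightarrow> real^4 \<Rightarrow> complex" where
  "phi k t = exp (complex_of_real (pi / 2 * (\<Sum>i\<in>UNIV. real_of_int (k$i) * t$i)) * \<i>)"

definition permv :: "real^4 \<Rightarrow> (4 \<Rightarrow> 4) \<Rightarrow> real^4" where
  "permv t \<sigma> = (\<chi> i. t $ \<sigma> i)"

definition TS :: "int^4 \<Rightarrow> real^4 \<Rightarrow> complex" where
  "TS k t = - (1/24) * (\<Sum>\<sigma>\<in>{\<sigma>. \<sigma> permutes (UNIV :: 4 set)}.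
       of_int (sign \<sigma>) * phi k (permv t \<sigma>))"

definition HH :: "(int^4) set" where
  "HH = {k. (\<Sum>i\<in>UNIV. k$i) = 0 \<and> (\<forall>i j. (k$i) mod 4 = (k$j) mod 4)}"

definition Lambda_circ :: "nat \<Rightarrow> (int^4) set" where
  "Lambda_circ n = {k \<in> HH. k$4 < k$3 \<and> k$3 < k$2 \<and> k$2 < k$1 \<and> k$1 < k$4 + 4 * int n}"

definition TS_space :: "nat \<Rightarrow> (real^4 \<Rightarrow> complex) set" where
  "TS_space n = {f. \<exists>c. f = (\<lambda>t. \<Sum>k\<in>Lambda_circ n. c k * TS k t)}"

definition triangle_H :: "(real^4) set" where
  "triangle_H = {t. (\<Sum>i\<in>UNIV. t$i) = 0 \<and> t$1 - t$2 \<in> {0..1} \<and> t$2 - t$3 \<in> {0..1}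
      \<and> t$3 - t$4 \<in> {0..1} \<and> t$1 - t$4 \<in> {0..1}}"

text \<open>Parametrisation of R^4_H by R^3; it scales 3-dim Lebesgue measure by a
 constant factor, which cancels in the normalised inner product.\<close>
definition Hpar :: "real^3 \<Rightarrow> real^4" where
  "Hpar x = vector [x$1, x$2, x$3, -(x$1 + x$2 + x$3)]"

definition ip_triangle :: "(real^4 \<Rightarrow> complex) \<Rightarrow> (real^4 \<Rightarrow> complex) \<Rightarrow> complex" where
  "ip_triangle f g =
     integral {x. Hpar x \<in> triangle_H} (\<lambda>x. f (Hpar x) * cnj (g (Hpar x)))
       / complex_of_real (measure lebesgue {x. Hpar x \<in> triangle_H})"

definition ip_disc :: "nat \<Rightarrow> (real^4 \<Rightarrow> complex) \<Rightarrow> (real^4 \<Rightarrow> complex) \<Rightarrow> complex" where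
  "ip_disc n f g = complex_of_real (6 / real n ^ 3) *
     (\<Sum>j\<in>Lambda_circ n. f (\<chi> i. real_of_int (j$i) / (4 * real n))
                       * cnj (g (\<chi> i. real_of_int (j$i) / (4 * real n))))"

end

theory Submission
  imports Defs
begin

text \<open>
  Both sides are sesquilinear, and for fixed \<open>f, g\<close> the discrete products of order \<open>m\<close> are
  Riemann sums of the integral over the alcove, written in the gap coordinates
  \<open>t\<^sub>1 - t\<^sub>2, t\<^sub>2 - t\<^sub>3, t\<^sub>3 - t\<^sub>4\<close>. So it suffices that the discrete product of two basis functions
  does not depend on \<open>m \<ge> n\<close>, and in fact it is \<open>\<delta>/24\<close>.

  The product of two antisymmetric functions whose indices have the same residue modulo 4 is a
  symmetric function of four points on the circle that is invariant under simultaneous rotation.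
  Its sum over all \<open>y \<in> {0..<m}\<^sup>4\<close> factors into geometric sums. That sum is 24 times the sum over
  decreasing \<open>y\<close>, where the gaps \<open>(a, b, c)\<close> occur \<open>d = m - a - b - c\<close> times. Averaging over the
  cyclic rotations of \<open>(a, b, c, d)\<close> replaces the weight \<open>d\<close> by the constant \<open>m/4\<close>. For different
  residues, the same rotation multiplies the summand by a nontrivial fourth root of unity, so
  that the sum vanishes.
\<close>

section \<open>Invariances of the alternating sums\<close>

definition alt :: "int^4 \<Rightarrow> real^4 \<Rightarrow> complex" where
  "alt k t = (\<Sum>\<sigma>\<in>{\<sigma>. \<sigma> permutes (UNIV :: 4 set)}. of_int (sign \<sigma>) * phi k (permv t \<sigma>))"

lemma TS_eq_alt: "TS k t = - (1/24) * alt k t"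
  by (simp add: TS_def alt_def)

lemma phi_add: "phi k (s + t) = phi k s * phi k t"
  by (simp add: phi_def ring_distribs sum.distrib exp_add[symmetric])

lemma phi_diag:
  assumes "(\<Sum>i\<in>UNIV. k $ i) = 0"
  shows "phi k (\<chi> i. c) = 1"
proof -
  have "(\<Sum>i\<in>UNIV. real_of_int (k $ i) * c) = 0"
    using assms by (simp add: sum_distrib_right[symmetric] of_int_sum[symmetric] del: of_int_sum)
  then show ?thesis by (simp add: phi_def)
qed

lemma phi_axis: "phi k (axis i 1) = \<i> powi (k $ i)"
proof -
  have "(\<Sum>j\<in>UNIV. real_of_int (k $ j) * (axis i 1 :: real^4) $ j) = of_int (k $ i)"
    by (simp add: axis_def if_distrib[of "(*) _"] cong: if_cong)
  moreover have "\<i> powi (k $ i) = cis (pi / 2) powi (k $ i)" by (simp add: cis_pi_half)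
  ultimately show ?thesis
    by (simp only: phi_def cis_power_int) (simp add: cis_conv_exp mult_ac)
qed

lemma i_powi_cong:
  assumes "a mod 4 = b mod (4::int)"
  shows "\<i> powi a = \<i> powi b"
proof -
  have *: "\<i> powi c = \<i> powi (c mod 4)" for c
  proof -
    have "\<i> powi c = \<i> powi (4 * (c div 4) + c mod 4)" by simp
    also have "\<dots> = \<i> powi (4 * (c div 4)) * \<i> powi (c mod 4)"
      by (rule power_int_add) simp
    also have "\<i> powi (4 * (c div 4)) = (\<i> powi 4) powi (c div 4)"
      by (rule power_int_mult)
    finally show ?thesis by simp
  qed
  show ?thesis using *[of a] *[of b] assms by simp
qed

lemma i_powi_eqD:
  assumes "\<i> powi a = \<i> powi b"
  shows "a mod 4 = b mod (4::int)"
proof -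
  define c where "c = (a - b) mod 4"
  have "\<i> powi (a - b) = 1" using assms by (simp add: power_int_diff)
  then have 1: "\<i> powi c = 1" using i_powi_cong[of "a - b" c] by (simp add: c_def)
  have "c \<in> {0..<4}" by (simp add: c_def)
  then have "c = 0 \<or> c = 1 \<or> c = 2 \<or> c = 3" by auto
  with 1 have "c = 0" by (auto simp: complex_eq_iff power_int_def power3_eq_cube)
  then show ?thesis by (simp add: c_def mod_eq_dvd_iff mod_eq_0_iff_dvd)
qed

lemma permv_permv: "permv (permv t p) q = permv t (p \<circ> q)"
  by (simp add: permv_def)

lemma of_int_sign_mult_self [simp]: "of_int (sign p) * of_int (sign p) = (1 :: complex)"
  by (simp add: of_int_mult[symmetric] sign_idempotent del: of_int_mult)

text \<open>Reindexing the sum over the group by \<open>p \<circ> \<sigma>\<close> pulls out the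
  sign of \<open>p\<close>.\<close>

lemma alt_permv:
  assumes "p permutes UNIV"
  shows "alt k (permv t p) = of_int (sign p) * alt k t"
proof -
  have p: "permutation p" using assms by (auto intro: permutes_imp_permutation[of UNIV])
  have "alt k t = (\<Sum>\<sigma>\<in>{\<sigma>. \<sigma> permutes (UNIV :: 4 set)}. of_int (sign (p \<circ> \<sigma>)) * phi k (permv t (p \<circ> \<sigma>)))"
    unfolding alt_def by (rule setum_permutations_compose_left[OF assms])
  also have "\<dots> = (\<Sum>\<sigma>\<in>{\<sigma>. \<sigma> permutes (UNIV :: 4 set)}. of_int (sign p) * (of_int (sign \<sigma>) * phi k (permv (permv t p) \<sigma>)))"
  proof (rule sum.cong[OF refl])
    fix \<sigma> :: "4 \<Rightarrow> 4" assume "\<sigma> \<in> {\<sigma>. \<sigma> permutes (UNIV :: 4 set)}"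
    then have "permutation \<sigma>" by (auto intro: permutes_imp_permutation[of UNIV])
    then show "of_int (sign (p \<circ> \<sigma>)) * phi k (permv t (p \<circ> \<sigma>)) =
        of_int (sign p) * (of_int (sign \<sigma>) * phi k (permv (permv t p) \<sigma>))"
      by (simp add: sign_compose p permv_permv)
  qed
  also have "\<dots> = of_int (sign p) * alt k (permv t p)"
    by (simp add: alt_def sum_distrib_left)
  finally have "of_int (sign p) * alt k t = (of_int (sign p) * of_int (sign p)) * alt k (permv t p)" by simp
  then show ?thesis by simp
qed

text \<open>The diagonal direction is orthogonal to \<open>k\<close>, so \<open>alt k\<close> sees
  only coordinate differences. Integer grid points outside the hyperplane may thus serve as
  arguments.\<close>

lemma alt_add_diag:
  assumes "(\<Sum>i\<in>UNIV. k $ i) = 0"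
  shows "alt k (t + (\<chi> i. c)) = alt k t"
proof -
  have "permv (t + (\<chi> i. c)) \<sigma> = permv t \<sigma> + (\<chi> i. c)" for \<sigma>
    by (simp add: permv_def vec_eq_iff)
  then show ?thesis by (simp add: alt_def phi_add phi_diag assms)
qed

text \<open>Shifting coordinate \<open>i\<close> of \<open>t\<close> multiplies the term of
  \<open>\<sigma>\<close> by \<open>\<i> powi (k $ inv \<sigma> i)\<close>. As the coordinates of
  \<open>k\<close> are congruent modulo 4, this factor is the same for all \<open>\<sigma>\<close>
  and leaves the sum.\<close>

lemma alt_add_axis:
  assumes "\<And>i j. k $ i mod 4 = k $ j mod 4"
  shows "alt k (t + axis i 1) = \<i> powi (k $ 4) * alt k t"
proof -
  have "phi k (permv (t + axis i 1) \<sigma>) = \<i> powi (k $ 4) * phi k (permv t \<sigma>)"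
    if "\<sigma> permutes UNIV" for \<sigma>
  proof -
    have "permv (t + axis i 1) \<sigma> = permv t \<sigma> + axis (inv \<sigma> i) 1"
      using permutes_inverses[OF that] by (auto simp: permv_def vec_eq_iff axis_def)
    then have "phi k (permv (t + axis i 1) \<sigma>) = \<i> powi (k $ (inv \<sigma> i)) * phi k (permv t \<sigma>)"
      by (simp add: phi_add phi_axis)
    then show ?thesis using i_powi_cong[OF assms] by metis
  qed
  then show ?thesis
    by (auto simp: alt_def sum_distrib_left algebra_simps intro!: sum.cong)
qed

text \<open>The point of \<open>\<real>\<^sup>4\<^sub>H\<close> whose consecutive coordinate differences are \<open>a, b, c\<close>.\<close>
definition gapv :: "real \<Rightarrow> real \<Rightarrow> real \<Rightarrow> real^4" where
  "gapv a b c = vector [(3*a+2*b+c)/4, (-a+2*b+c)/4, (-a-2*b+c)/4, (-a-2*b-3*c)/4]"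

lemma gapv_nth [simp]:
  "gapv a b c $ 1 = (3*a+2*b+c)/4" "gapv a b c $ 2 = (-a+2*b+c)/4"
  "gapv a b c $ 3 = (-a-2*b+c)/4" "gapv a b c $ 4 = (-a-2*b-3*c)/4"
  by (simp_all add: gapv_def vector_def numeral_eq_Suc)

lemma alt_gapv:
  assumes "(\<Sum>i\<in>UNIV. k $ i) = 0"
    and "t $ 1 - t $ 2 = a" "t $ 2 - t $ 3 = b" "t $ 3 - t $ 4 = c"
  shows "alt k t = alt k (gapv a b c)"
proof -
  \<comment> \<open>The shift is the difference of the fourth coordinates of \<open>t\<close> and
    \<open>gapv a b c\<close>.\<close>
  have "t = gapv a b c + (\<chi> i. t $ 4 + (a + 2 * b + 3 * c) / 4)"
    using assms(2-4) by (auto simp: vec_eq_iff forall_4 field_simps)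
  then show ?thesis using alt_add_diag[OF assms(1)] by metis
qed

text \<open>Arithmetic in the type \<open>4\<close> is modulo 4, so that \<open>i + 1\<close> sends
  the index 4 to 1 and is a 4-cycle.\<close>

lemma five_eq_one: "(5::4) = 1"
  by simp

text \<open>Moving the largest coordinate below the smallest one by an integer translation permutes the
  four gaps \<open>a, b, c, 1 - a - b - c\<close> cyclically.\<close>
lemma alt_gapv_cycle:
  assumes "(\<Sum>i\<in>UNIV. k $ i) = 0" and "\<And>i j. k $ i mod 4 = k $ j mod 4"
  shows "alt k (gapv a b c) = of_int (sign (\<lambda>i::4. i + 1)) * \<i> powi (k $ 4) * alt k (gapv b c (1 - a - b - c))"
proof -
  have p: "(\<lambda>i::4. i + 1) permutes UNIV"
    by (simp add: permutes_def) (metis add.commute add_diff_cancel_right' diff_add_cancel)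
  have "of_int (sign (\<lambda>i::4. i + 1)) * alt k (gapv a b c) = alt k (permv (gapv a b c) (\<lambda>i. i + 1))"
    by (simp add: alt_permv[OF p])
  also have "\<dots> = alt k ((permv (gapv a b c) (\<lambda>i. i + 1) - axis 4 1) + axis 4 1)" by simp
  also have "\<dots> = \<i> powi (k $ 4) * alt k (permv (gapv a b c) (\<lambda>i. i + 1) - axis 4 1)"
    by (rule alt_add_axis[OF assms(2)])
  \<comment> \<open>The point is \<open>(t2, t3, t4, t1 - 1)\<close>, with last gap
    \<open>t4 - t1 + 1 = 1 - a - b - c\<close>.\<close>
  also have "alt k (permv (gapv a b c) (\<lambda>i. i + 1) - axis 4 1) = alt k (gapv b c (1 - a - b - c))"
    by (rule alt_gapv[OF assms(1)])
       (simp_all add: permv_def five_eq_one axis_def field_simps)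
  finally have "of_int (sign (\<lambda>i::4. i + 1)) * (of_int (sign (\<lambda>i::4. i + 1)) * alt k (gapv a b c)) =
    of_int (sign (\<lambda>i::4. i + 1)) * (\<i> powi (k $ 4) * alt k (gapv b c (1 - a - b - c)))" by simp
  then show ?thesis by (simp add: mult.assoc[symmetric])
qed

section \<open>Sums over gaps and over grid points\<close>

definition decreasing4 :: "(4 \<Rightarrow> int) \<Rightarrow> bool" where
  "decreasing4 y \<longleftrightarrow> y 4 < y 3 \<and> y 3 < y 2 \<and> y 2 < y 1"

definition box4 :: "nat \<Rightarrow> (4 \<Rightarrow> int) set" where
  "box4 n = {y. \<forall>i. y i \<in> {0..<int n}}"

lemma box4_eq_PiE: "box4 n = PiE UNIV (\<lambda>_. {0..<int n})"
  by (auto simp: box4_def PiE_def)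

lemma finite_box4: "finite (box4 n)"
  unfolding box4_eq_PiE by (rule finite_PiE) auto

lemma range_4: "range y = {y 4, y 3, y 2, y (1::4)}"
  by (auto simp: UNIV_4)

lemma decreasing4_inj: "decreasing4 y \<Longrightarrow> inj y"
  by (auto simp: decreasing4_def inj_def forall_4)

text \<open>Both tuples have the same values, and a finite set of integers can be listed in strict
  order in only one way. Injectivity of the common tuple then forces
  \<open>\<sigma> = id\<close>.\<close>

lemma decreasing4_unique:
  assumes "decreasing4 y" "decreasing4 z" "\<sigma> permutes UNIV" "y = z \<circ> \<sigma>"
  shows "y = z" "\<sigma> = id"
proof -
  have "range y = range z"
    using permutes_image[OF assms(3)] assms(4) by (metis image_comp)
  then have "set [y 4, y 3, y 2, y 1] = set [z 4, z 3, z 2, z 1]"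
    unfolding range_4 by simp
  then have "[y 4, y 3, y 2, y 1] = [z 4, z 3, z 2, z 1]"
    by (rule sorted_distinct_set_unique[rotated 4]) (use assms(1,2) in \<open>auto simp: decreasing4_def\<close>)
  then show yz: "y = z" by (auto simp: fun_eq_iff forall_4)
  show "\<sigma> = id"
    using injD[OF decreasing4_inj[OF assms(2)]] assms(4) unfolding yz by (auto simp: fun_eq_iff)
qed

lemma inj_imp_decreasing4_rearrangement:
  fixes y :: "4 \<Rightarrow> int"
  assumes "inj y"
  obtains z \<sigma> where "decreasing4 z" "\<sigma> permutes UNIV" "y = z \<circ> \<sigma>" "range z = range y"
proof -
  define xs where "xs = sorted_list_of_set (range y)"
  have "length xs = 4" using assms by (simp add: xs_def card_image)
  \<comment> \<open>The sorted list increases while \<open>z\<close> must decrease, hence the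
    reversed names.\<close>
  then obtain a b c d where xs: "xs = [d, c, b, a]"
    by (auto simp: numeral_eq_Suc length_Suc_conv)
  have "sorted_wrt (<) xs" unfolding xs_def by simp
  then have less: "d < c" "c < b" "b < a" by (auto simp: xs)
  define z :: "4 \<Rightarrow> int" where
    "z = (\<lambda>i. if i = 1 then a else if i = 2 then b else if i = 3 then c else d)"
  have z: "z 1 = a" "z 2 = b" "z 3 = c" "z 4 = d" by (simp_all add: z_def)
  have dec: "decreasing4 z" using less by (simp add: decreasing4_def z del: z_def)
  have "set xs = range y" by (simp add: xs_def)
  then have rng: "range z = range y" unfolding range_4[of z] z by (simp add: xs)
  define \<sigma> where "\<sigma> = inv z \<circ> y"
  have y: "y = z \<circ> \<sigma>"
    using rng by (auto simp: \<sigma>_def fun_eq_iff intro!: f_inv_into_f[symmetric])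
  have "inj \<sigma>" using assms unfolding y by (rule inj_on_imageI2)
  then have "\<sigma> permutes UNIV" by (auto intro!: bij_imp_permutes simp: bij_def finite_UNIV_inj_surj)
  with dec y rng show ?thesis using that by blast
qed

lemma card_permutations_4: "card {\<sigma>. \<sigma> permutes (UNIV :: 4 set)} = 24"
  using card_permutations[of "UNIV :: 4 set" 4] by (simp add: fact_numeral)

text \<open>Every injective tuple is \<open>z \<circ> \<sigma>\<close> for exactly one decreasing
  \<open>z\<close> and one of the 24 permutations \<open>\<sigma>\<close>; tuples with a repeated
  value contribute nothing.\<close>

lemma sum_box4_antisym:
  fixes G :: "(4 \<Rightarrow> int) \<Rightarrow> complex"
  assumes sym: "\<And>y \<sigma>. \<sigma> permutes UNIV \<Longrightarrow> G (y \<circ> \<sigma>) = G y"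
    and zero: "\<And>y. \<not> inj y \<Longrightarrow> G y = 0"
  shows "(\<Sum>y\<in>box4 n. G y) = 24 * (\<Sum>y\<in>{y\<in>box4 n. decreasing4 y}. G y)"
proof -
  let ?D = "{y\<in>box4 n. decreasing4 y}" and ?P = "{\<sigma>. \<sigma> permutes (UNIV :: 4 set)}"
  let ?f = "\<lambda>(z, \<sigma>). z \<circ> \<sigma>"
  have inj: "inj_on ?f (?D \<times> ?P)"
  proof (rule inj_onI, clarsimp)
    fix z z' :: "4 \<Rightarrow> int" and s s' :: "4 \<Rightarrow> 4"
    assume *: "decreasing4 z" "decreasing4 z'" "s permutes UNIV" "s' permutes UNIV" "z \<circ> s = z' \<circ> s'"
    \<comment> \<open>Cancelling \<open>s\<close> leaves one permutation
      \<open>s' \<circ> inv s\<close> between two decreasing tuples.\<close>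
    have "z = z \<circ> s \<circ> inv s" by (simp add: o_assoc[symmetric] permutes_inv_o[OF *(3)])
    also have "\<dots> = z' \<circ> (s' \<circ> inv s)" by (simp add: *(5) o_assoc)
    finally have "z = z'" "s' \<circ> inv s = id"
      using decreasing4_unique[OF *(1,2) permutes_compose[OF permutes_inv[OF *(3)] *(4)]] by auto
    moreover have "s' = (s' \<circ> inv s) \<circ> s" by (simp add: o_assoc[symmetric] permutes_inv_o[OF *(3)])
    ultimately show "z = z' \<and> s = s'" by simp
  qed
  have img: "?f ` (?D \<times> ?P) = {y\<in>box4 n. inj y}"
  proof (intro equalityI subsetI)
    fix y assume "y \<in> ?f ` (?D \<times> ?P)"
    then show "y \<in> {y\<in>box4 n. inj y}"
      by (auto simp: box4_def simp del: o_apply intro!: inj_compose dest: decreasing4_inj permutes_inj)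
        (auto simp: box4_def)
  next
    fix y assume y: "y \<in> {y\<in>box4 n. inj y}"
    then obtain z \<sigma> where z: "decreasing4 z" "\<sigma> permutes UNIV" "y = z \<circ> \<sigma>" "range z = range y"
      using inj_imp_decreasing4_rearrangement by blast
    have "range y \<subseteq> {0..<int n}" using y by (auto simp: box4_def)
    then have "z i \<in> {0..<int n}" for i using z(4) by blast
    then have "z \<in> box4 n" by (simp add: box4_def)
    then show "y \<in> ?f ` (?D \<times> ?P)" using z by force
  qed
  have "(\<Sum>y\<in>box4 n. G y) = (\<Sum>y\<in>{y\<in>box4 n. inj y}. G y)"
    by (rule sum.mono_neutral_right) (auto simp: finite_box4 zero)
  also have "\<dots> = (\<Sum>(z, \<sigma>)\<in>?D \<times> ?P. G (z \<circ> \<sigma>))"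
    unfolding img[symmetric] by (subst sum.reindex[OF inj]) (auto intro!: sum.cong)
  also have "\<dots> = (\<Sum>(z, \<sigma>)\<in>?D \<times> ?P. G z)"
    by (rule sum.cong) (auto simp: sym)
  also have "\<dots> = (\<Sum>z\<in>?D. \<Sum>\<sigma>\<in>?P. G z)"
    by (rule sum.cartesian_product[symmetric])
  also have "\<dots> = 24 * (\<Sum>z\<in>?D. G z)"
    by (simp add: card_permutations_4 sum_distrib_left)
  finally show ?thesis .
qed

text \<open>Gaps between four points in order on a circle of circumference \<open>n\<close>; the
  fourth gap \<open>n - a - b - c\<close> is positive too.\<close>

definition gaps :: "nat \<Rightarrow> (int \<times> int \<times> int) set" where
  "gaps n = {(a, b, c). 1 \<le> a \<and> 1 \<le> b \<and> 1 \<le> c \<and> a + b + c < int n}"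

lemma finite_gaps: "finite (gaps n)"
  by (rule finite_subset[of _ "{0..int n} \<times> {0..int n} \<times> {0..int n}"]) (auto simp: gaps_def)

text \<open>A decreasing tuple is given by its gaps and its least entry \<open>y 4\<close>, which
  has \<open>n - a - b - c\<close> possible values once the gaps are fixed.\<close>

lemma sum_decreasing4_gaps:
  fixes H :: "int \<Rightarrow> int \<Rightarrow> int \<Rightarrow> complex"
  shows "(\<Sum>y\<in>{y\<in>box4 n. decreasing4 y}. H (y 1 - y 2) (y 2 - y 3) (y 3 - y 4)) =
    (\<Sum>(a, b, c)\<in>gaps n. of_int (int n - a - b - c) * H a b c)"
proof -
  let ?S = "Sigma (gaps n) (\<lambda>(a, b, c). {0..<int n - a - b - c})"
  have "(\<Sum>y\<in>{y\<in>box4 n. decreasing4 y}. H (y 1 - y 2) (y 2 - y 3) (y 3 - y 4)) =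
    (\<Sum>((a, b, c), d)\<in>?S. H a b c)"
    by (rule sum.reindex_bij_witness[where j = "\<lambda>y. ((y 1 - y 2, y 2 - y 3, y 3 - y 4), y 4)"
        and i = "\<lambda>((a, b, c), d) i. if i = 1 then a + b + c + d else if i = 2 then b + c + d
          else if i = 3 then c + d else d"])
      (auto simp: box4_def decreasing4_def gaps_def forall_4 fun_eq_iff)
  also have "\<dots> = (\<Sum>(a, b, c)\<in>gaps n. \<Sum>d\<in>{0..<int n - a - b - c}. H a b c)"
    by (subst sum.Sigma[symmetric]) (auto simp: finite_gaps case_prod_unfold)
  also have "\<dots> = (\<Sum>(a, b, c)\<in>gaps n. of_int (int n - a - b - c) * H a b c)"
    by (rule sum.cong) (auto simp: gaps_def of_nat_nat)
  finally show ?thesis .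
qed

text \<open>Rotating the four gaps, all at least 1 and of sum \<open>n\<close>, is a bijection of
  \<open>gaps n\<close>.\<close>

lemma sum_gaps_cycle:
  fixes H :: "int \<Rightarrow> int \<Rightarrow> int \<Rightarrow> complex"
  shows "(\<Sum>(a, b, c)\<in>gaps n. H b c (int n - a - b - c)) = (\<Sum>(a, b, c)\<in>gaps n. H a b c)"
  by (rule sum.reindex_bij_witness[where j = "\<lambda>(a, b, c). (b, c, int n - a - b - c)"
        and i = "\<lambda>(b, c, d). (int n - b - c - d, b, c)"])
     (auto simp: gaps_def)

text \<open>Rotation turns the weight into each of the four gaps in turn without changing the sum,
  and the four weights add up to \<open>n\<close>.\<close>

lemma sum_gaps_weighted:
  fixes H :: "int \<Rightarrow> int \<Rightarrow> int \<Rightarrow> complex"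
  assumes cyc: "\<And>a b c. H b c (int n - a - b - c) = H a b c"
  shows "4 * (\<Sum>(a, b, c)\<in>gaps n. of_int (int n - a - b - c) * H a b c) =
    of_nat n * (\<Sum>(a, b, c)\<in>gaps n. H a b c)"
proof -
  let ?S = "\<lambda>w. (\<Sum>(a, b, c)\<in>gaps n. of_int (w a b c) * H a b c)"
  have step: "?S (\<lambda>a b c. w b c (int n - a - b - c)) = ?S w" for w :: "int \<Rightarrow> int \<Rightarrow> int \<Rightarrow> int"
    using sum_gaps_cycle[of "\<lambda>a b c. of_int (w a b c) * H a b c" n] by (simp only: cyc)
  let ?d = "\<lambda>a b c. int n - a - b - c"
  have a: "?S ?d = ?S (\<lambda>a b c. a)" using step[of ?d] by (simp add: algebra_simps)
  have b: "?S (\<lambda>a b c. a) = ?S (\<lambda>a b c. b)" using step[of "\<lambda>a b c. a"] by simp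
  have c: "?S (\<lambda>a b c. b) = ?S (\<lambda>a b c. c)" using step[of "\<lambda>a b c. b"] by simp
  have "4 * ?S ?d = ?S ?d + ?S (\<lambda>a b c. a) + ?S (\<lambda>a b c. b) + ?S (\<lambda>a b c. c)"
    using a b c by simp
  also have "\<dots> = of_nat n * (\<Sum>(a, b, c)\<in>gaps n. H a b c)"
    by (simp only: sum.distrib[symmetric] sum_distrib_left)
       (rule sum.cong, auto simp: algebra_simps)
  finally show ?thesis .
qed

section \<open>Geometric sums over roots of unity\<close>

lemma sum_cis_root_of_unity:
  fixes n :: nat and m :: int
  assumes "n > 0"
  shows "(\<Sum>y\<in>{0..<int n}. cis (2 * pi * of_int m * of_int y / of_nat n)) =
    (if int n dvd m then of_nat n else 0)"
proof -
  define \<omega> where "\<omega> = cis (2 * pi * of_int m / of_nat n)"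
  have "(\<Sum>y\<in>{0..<int n}. cis (2 * pi * of_int m * of_int y / of_nat n)) = (\<Sum>i<n. \<omega> ^ i)"
    by (rule sum.reindex_bij_witness[where i = int and j = nat])
       (auto simp: \<omega>_def Complex.DeMoivre algebra_simps)
  also have "\<dots> = (if int n dvd m then of_nat n else 0)"
  proof (cases "int n dvd m")
    case True
    then obtain q where q: "m = int n * q" by auto
    have "2 * pi * of_int m / of_nat n = 2 * pi * of_int q" using assms by (simp add: q)
    then have "\<omega> = 1" unfolding \<omega>_def by (metis cis_multiple_2pi Ints_of_int)
    with True show ?thesis by simp
  next
    case False
    have "\<omega> ^ n = cis (2 * pi * of_int m)" using assms by (simp add: \<omega>_def Complex.DeMoivre)
    also have "\<dots> = 1" by (rule cis_multiple_2pi) simp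
    finally have 1: "\<omega> ^ n = 1" .
    have "\<omega> \<noteq> 1"
    proof
      assume "\<omega> = 1"
      then have "cos (2 * pi * of_int m / of_nat n) = 1" by (simp add: \<omega>_def complex_eq_iff)
      then obtain x :: int where "2 * pi * of_int m / of_nat n = of_int x * 2 * pi"
        using cos_one_2pi_int by blast
      then have "real_of_int m = of_int (x * int n)" using assms by (simp add: field_simps)
      then have "m = x * int n" by linarith
      with False show False by simp
    qed
    then show ?thesis using False 1 by (simp add: geometric_sum)
  qed
  finally show ?thesis .
qed

section \<open>Discrete orthogonality\<close>

lemma Lambda_circ_D:
  assumes "k \<in> Lambda_circ n"
  shows "(\<Sum>i\<in>UNIV. k $ i) = 0" "k $ i mod 4 = k $ j mod 4"
    "decreasing4 (($) k)" "k $ 1 < k $ 4 + 4 * int n"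
  using assms by (auto simp: Lambda_circ_def HH_def decreasing4_def)

text \<open>At grid points \<open>phi m\<close> is a product over the coordinates of powers of
  \<open>n\<close>-th roots of unity, because 4 divides each \<open>m $ i\<close>. The sum over the
  box is therefore a product of four geometric sums.\<close>

lemma sum_box4_phi:
  assumes "n > 0" and m: "\<And>i. 4 dvd m $ i"
  shows "(\<Sum>y\<in>box4 n. phi m (\<chi> i. of_int (y i) / of_nat n)) =
    (if \<forall>i. 4 * int n dvd m $ i then of_nat n ^ 4 else 0)"
proof -
  have "phi m (\<chi> i. of_int (y i) / of_nat n) =
      (\<Prod>i\<in>UNIV. cis (2 * pi * of_int (m $ i div 4) * of_int (y i) / of_nat n))" for y :: "4 \<Rightarrow> int"
  proof -
    have "real_of_int (m $ i) = 4 * of_int (m $ i div 4)" for i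
      using m[of i] by (metis dvd_mult_div_cancel of_int_mult of_int_numeral)
    then have *: "pi / 2 * (of_int (m $ i) * (of_int (y i) / of_nat n)) =
        2 * pi * of_int (m $ i div 4) * of_int (y i) / of_nat n" for i
      by (simp add: field_simps)
    show ?thesis
      by (simp only: cis_conv_exp phi_def exp_sum[symmetric] finite sum_distrib_left vec_lambda_beta *
          of_real_sum sum_distrib_right) (simp add: mult_ac)
  qed
  then have "(\<Sum>y\<in>box4 n. phi m (\<chi> i. of_int (y i) / of_nat n)) =
      (\<Prod>i\<in>UNIV. \<Sum>y\<in>{0..<int n}. cis (2 * pi * of_int (m $ i div 4) * of_int y / of_nat n))"
    unfolding box4_eq_PiE by (simp add: prod_sum_PiE)
  also have "\<dots> = (\<Prod>i\<in>UNIV. if int n dvd m $ i div 4 then of_nat n else 0)"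
    by (simp add: sum_cis_root_of_unity[OF assms(1)])
  also have "\<dots> = (if \<forall>i. int n dvd m $ i div 4 then of_nat n ^ 4 else 0)"
    by (auto simp: prod_zero_iff)
  also have "(\<forall>i. int n dvd m $ i div 4) \<longleftrightarrow> (\<forall>i. 4 * int n dvd m $ i)"
    using m by (simp add: dvd_div_iff_mult mult.commute)
  finally show ?thesis .
qed

text \<open>Permuting the point amounts to permuting the index by the inverse, and conjugation
  negates the index, so the product is again a single exponential.\<close>

lemma phi_mult_cnj_phi_permv:
  assumes "\<tau> permutes UNIV"
  shows "phi k t * cnj (phi l (permv t \<tau>)) = phi (\<chi> i. k $ i - l $ inv \<tau> i) t"
proof -
  have cnj_exp: "cnj (exp (complex_of_real x * \<i>)) = exp (- (complex_of_real x * \<i>))" for x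
    by (simp add: exp_cnj)
  have "(\<Sum>i\<in>UNIV. real_of_int (l $ i) * permv t \<tau> $ i) = (\<Sum>i\<in>UNIV. real_of_int (l $ inv \<tau> i) * t $ i)"
    by (subst sum.permute[OF assms]) (simp add: permv_def o_def permutes_inverses[OF assms])
  then have "cnj (phi l (permv t \<tau>)) = exp (- (complex_of_real (pi / 2 * (\<Sum>i\<in>UNIV. real_of_int (l $ inv \<tau> i) * t $ i)) * \<i>))"
    by (simp only: phi_def cnj_exp)
  then show ?thesis
    by (simp add: phi_def exp_add[symmetric] left_diff_distrib right_diff_distrib sum_subtractf)
qed

text \<open>The window condition \<open>k\<^sub>1 < k\<^sub>4 + 4n\<close> makes the indices of \<open>\<Lambda>\<^sub>n\<close> inequivalent under the affine Weyl group.\<close>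
lemma Lambda_circ_cong_imp_eq:
  assumes k: "k \<in> Lambda_circ n" and l: "l \<in> Lambda_circ n" and \<tau>: "\<tau> permutes UNIV"
    and dvd: "\<And>i. 4 * int n dvd k $ i - l $ inv \<tau> i"
  shows "k = l" "\<tau> = id"
proof -
  have "\<forall>i. \<exists>m. k $ i - l $ inv \<tau> i = 4 * int n * m" using dvd by blast
  then obtain m where m: "\<And>i. k $ i - l $ inv \<tau> i = 4 * int n * m i" by metis
  have range: "x $ i - x $ j < 4 * int n" if "x \<in> Lambda_circ n" for x i j
  proof -
    have "x $ i \<le> x $ 1" "x $ 4 \<le> x $ j"
      using Lambda_circ_D(3)[OF that] exhaust_4[of i] exhaust_4[of j] by (auto simp: decreasing4_def)
    then show ?thesis using Lambda_circ_D(4)[OF that] by simp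
  qed
  have n: "n > 0" using range[OF k, of 1 1] by simp
  \<comment> \<open>The coordinates of \<open>k\<close> and of \<open>l\<close> each spread over
    less than \<open>4 * n\<close>, so the multiples \<open>m i\<close> differ by at most 1.\<close>
  have diff: "m i - m j < 2" for i j
  proof -
    have "4 * int n * (m i - m j) = (k $ i - k $ j) + (l $ inv \<tau> j - l $ inv \<tau> i)"
      using m[of i] m[of j] by (simp add: algebra_simps)
    also have "\<dots> < 4 * int n * 2" using range[OF k, of i j] range[OF l, of "inv \<tau> j" "inv \<tau> i"] by simp
    finally show ?thesis using n by simp
  qed
  have "(\<Sum>i\<in>UNIV. l $ inv \<tau> i) = (\<Sum>i\<in>UNIV. l $ i)"
    by (rule sum.permute[OF permutes_inv[OF \<tau>], unfolded o_def, symmetric])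
  then have "4 * int n * (\<Sum>i\<in>UNIV. m i) = 0"
    using Lambda_circ_D(1)[OF k] Lambda_circ_D(1)[OF l] by (simp add: sum_distrib_left m[symmetric] sum_subtractf)
  then have "(\<Sum>i\<in>UNIV. m i) = 0" using n by simp
  \<comment> \<open>Four integers that pairwise differ by at most 1 and have sum 0 all
    vanish.\<close>
  then have "m i = 0" for i
    using exhaust_4[of i] diff[of 1 2] diff[of 1 3] diff[of 1 4] diff[of 2 1] diff[of 2 3] diff[of 2 4]
      diff[of 3 1] diff[of 3 2] diff[of 3 4] diff[of 4 1] diff[of 4 2] diff[of 4 3]
    by (auto simp: sum_4)
  then have "k $ i = l $ inv \<tau> i" for i using m[of i] by simp
  then have "($) k = ($) l \<circ> inv \<tau>" by auto
  then have "($) k = ($) l" "inv \<tau> = id"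
    using decreasing4_unique[OF Lambda_circ_D(3)[OF k] Lambda_circ_D(3)[OF l] permutes_inv[OF \<tau>]] by auto
  then show "k = l" "\<tau> = id"
    by (auto simp: vec_eq_iff) (metis \<tau> inv_id permutes_inv_inv)
qed

text \<open>The transposition of \<open>i\<close> and \<open>j\<close> fixes \<open>t\<close> but
  changes the sign of \<open>alt k t\<close>.\<close>

lemma alt_eq_zero:
  assumes "t $ i = t $ j" "i \<noteq> j"
  shows "alt k t = 0"
proof -
  have "permv t (Transposition.transpose i j) = t" using assms by (auto simp: permv_def vec_eq_iff Transposition.transpose_def)
  moreover have "alt k (permv t (Transposition.transpose i j)) = - alt k t"
    using assms(2) by (subst alt_permv) (auto simp: permutes_swap_id sign_swap_id)
  ultimately show ?thesis by simp
qed

text \<open>Expanding \<open>alt k\<close> gives 24 equal contributions, since the box is invariant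
  under permutations and \<open>alt l\<close> is antisymmetric. Expanding \<open>alt l\<close>
  leaves sums of single exponentials, of which only the one with \<open>\<tau> = id\<close> and
  \<open>k = l\<close> survives, with value \<open>n ^ 4\<close>.\<close>

lemma sum_box4_alt:
  assumes n: "n > 0" and k: "k \<in> Lambda_circ n" and l: "l \<in> Lambda_circ n"
    and kl: "k $ 4 mod 4 = l $ 4 mod 4"
  shows "(\<Sum>y\<in>box4 n. alt k (\<chi> i. of_int (y i) / of_nat n) * cnj (alt l (\<chi> i. of_int (y i) / of_nat n))) =
    (if k = l then 24 * of_nat n ^ 4 else 0)"
proof -
  define v :: "(4 \<Rightarrow> int) \<Rightarrow> real^4" where "v y = (\<chi> i. of_int (y i) / of_nat n)" for y
  have v: "v (y \<circ> \<sigma>) = permv (v y) \<sigma>" for y \<sigma> by (simp add: v_def permv_def)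
  let ?P = "{\<sigma>. \<sigma> permutes (UNIV :: 4 set)}"
  have 1: "(\<Sum>y\<in>box4 n. of_int (sign \<sigma>) * phi k (permv (v y) \<sigma>) * cnj (alt l (v y))) =
      (\<Sum>y\<in>box4 n. phi k (v y) * cnj (alt l (v y)))" if "\<sigma> permutes UNIV" for \<sigma>
  proof -
    have "of_int (sign \<sigma>) * phi k (permv (v y) \<sigma>) * cnj (alt l (v y)) =
        phi k (v (y \<circ> \<sigma>)) * cnj (alt l (v (y \<circ> \<sigma>)))" for y
      by (simp add: v alt_permv[OF that])
    then show ?thesis
      by (intro sum.reindex_bij_witness[where j = "\<lambda>y. y \<circ> \<sigma>" and i = "\<lambda>y. y \<circ> inv \<sigma>"])
         (auto simp: box4_def o_assoc[symmetric] permutes_inv_o[OF that])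
  qed
  have 2: "(\<Sum>y\<in>box4 n. phi k (v y) * cnj (phi l (permv (v y) \<tau>))) =
      (if k = l \<and> \<tau> = id then of_nat n ^ 4 else 0)" if "\<tau> permutes UNIV" for \<tau>
  proof -
    have "4 dvd k $ i - l $ inv \<tau> i" for i
      using kl Lambda_circ_D(2)[OF k, of i 4] Lambda_circ_D(2)[OF l, of "inv \<tau> i" 4]
      by (simp add: mod_eq_dvd_iff[symmetric])
    then have "(\<Sum>y\<in>box4 n. phi k (v y) * cnj (phi l (permv (v y) \<tau>))) =
        (if \<forall>i. 4 * int n dvd k $ i - l $ inv \<tau> i then of_nat n ^ 4 else 0)"
      unfolding phi_mult_cnj_phi_permv[OF that] v_def by (subst sum_box4_phi[OF n]) auto
    also have "(\<forall>i. 4 * int n dvd k $ i - l $ inv \<tau> i) \<longleftrightarrow> k = l \<and> \<tau> = id"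
      using Lambda_circ_cong_imp_eq[OF k l that] by auto
    finally show ?thesis .
  qed
  have "(\<Sum>y\<in>box4 n. alt k (v y) * cnj (alt l (v y))) =
      (\<Sum>\<sigma>\<in>?P. \<Sum>y\<in>box4 n. of_int (sign \<sigma>) * phi k (permv (v y) \<sigma>) * cnj (alt l (v y)))"
    by (subst sum.swap) (simp add: alt_def[of k] sum_distrib_right)
  also have "\<dots> = (\<Sum>\<sigma>\<in>?P. \<Sum>y\<in>box4 n. phi k (v y) * cnj (alt l (v y)))"
    by (rule sum.cong) (simp_all add: 1)
  also have "\<dots> = 24 * (\<Sum>y\<in>box4 n. phi k (v y) * cnj (alt l (v y)))"
    by (simp add: card_permutations_4)
  also have "(\<Sum>y\<in>box4 n. phi k (v y) * cnj (alt l (v y))) =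
      (\<Sum>\<tau>\<in>?P. of_int (sign \<tau>) * (\<Sum>y\<in>box4 n. phi k (v y) * cnj (phi l (permv (v y) \<tau>))))"
    unfolding sum_distrib_left by (subst sum.swap) (simp add: alt_def[of l] sum_distrib_left mult_ac)
  also have "\<dots> = (\<Sum>\<tau>\<in>?P. if \<tau> = id then (if k = l then of_nat n ^ 4 else 0) else 0)"
    by (rule sum.cong) (auto simp: 2)
  also have "\<dots> = (if k = l then of_nat n ^ 4 else 0)"
    by (simp add: sum.delta finite_permutations permutes_id)
  finally show ?thesis by (simp add: v_def)
qed

text \<open>For equal residues the average weight is \<open>n / 4\<close>, so the box sum is
  \<open>24 * (n / 4)\<close> times the gap sum; comparison with \<open>24 * n ^ 4\<close> gives
  \<open>4 * n ^ 3\<close>. For different residues the gap sum equals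
  \<open>\<omega> \<noteq> 1\<close> times itself.\<close>

lemma sum_gaps_alt:
  assumes n: "n > 0" and k: "k \<in> Lambda_circ n" and l: "l \<in> Lambda_circ n"
  shows "(\<Sum>(a, b, c)\<in>gaps n. alt k (gapv (a / n) (b / n) (c / n)) * cnj (alt l (gapv (a / n) (b / n) (c / n)))) =
    (if k = l then 4 * of_nat n ^ 3 else 0)"
proof -
  define H where "H a b c = alt k (gapv (of_int a / n) (of_int b / n) (of_int c / n)) *
      cnj (alt l (gapv (of_int a / n) (of_int b / n) (of_int c / n)))" for a b c :: int
  define \<omega> where "\<omega> = \<i> powi (k $ 4) * cnj (\<i> powi (l $ 4))"
  have cyc: "H a b c = \<omega> * H b c (int n - a - b - c)" for a b c
  proof -
    have *: "of_int (int n - a - b - c) / real n = 1 - a / n - b / n - c / n"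
      using n by (simp add: field_simps)
    \<comment> \<open>The sign of the 4-cycle comes once from each factor and cancels; only the
      powers of \<open>\<i>\<close> remain, in \<open>\<omega>\<close>.\<close>
    have "H a b c = of_int (sign (\<lambda>i::4. i + 1)) * of_int (sign (\<lambda>i::4. i + 1)) * \<omega> * H b c (int n - a - b - c)"
      unfolding H_def * \<omega>_def alt_gapv_cycle[OF Lambda_circ_D(1,2)[OF k], of "a / n" "b / n" "c / n"]
        alt_gapv_cycle[OF Lambda_circ_D(1,2)[OF l], of "a / n" "b / n" "c / n"]
      by (simp del: of_int_sign_mult_self add: mult_ac)
    then show ?thesis by simp
  qed
  have norm_i: "\<i> powi m * cnj (\<i> powi m) = 1" for m
    by (subst complex_norm_square[symmetric]) (simp add: norm_power_int)
  have "(\<Sum>(a, b, c)\<in>gaps n. H a b c) = (if k = l then 4 * of_nat n ^ 3 else 0)"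
  proof (cases "k $ 4 mod 4 = l $ 4 mod 4")
    case False
    have "\<omega> \<noteq> 1"
    proof
      assume "\<omega> = 1"
      then have "\<i> powi (l $ 4) = \<omega> * \<i> powi (l $ 4)" by simp
      also have "\<dots> = \<i> powi (k $ 4) * (\<i> powi (l $ 4) * cnj (\<i> powi (l $ 4)))"
        by (simp only: \<omega>_def mult_ac)
      finally have "\<i> powi (l $ 4) = \<i> powi (k $ 4)" by (simp only: norm_i mult_1_right)
      with False i_powi_eqD show False by metis
    qed
    have "(\<Sum>(a, b, c)\<in>gaps n. H a b c) = \<omega> * (\<Sum>(a, b, c)\<in>gaps n. H b c (int n - a - b - c))"
      by (subst cyc) (simp add: sum_distrib_left case_prod_unfold)
    then have "(1 - \<omega>) * (\<Sum>(a, b, c)\<in>gaps n. H a b c) = 0"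
      by (simp add: sum_gaps_cycle left_diff_distrib)
    with \<open>\<omega> \<noteq> 1\<close> False show ?thesis by auto
  next
    case True
    define G where "G y = alt k (\<chi> i. of_int (y i) / of_nat n) * cnj (alt l (\<chi> i. of_int (y i) / of_nat n))" for y
    have "\<omega> = 1" using i_powi_cong[OF True] norm_i by (simp add: \<omega>_def)
    then have H: "H b c (int n - a - b - c) = H a b c" for a b c using cyc by simp
    have "G y = H (y 1 - y 2) (y 2 - y 3) (y 3 - y 4)" for y
    proof -
      have "alt x (\<chi> i. of_int (y i) / of_nat n) = alt x (gapv (of_int (y 1 - y 2) / n)
          (of_int (y 2 - y 3) / n) (of_int (y 3 - y 4) / n))" if "x \<in> Lambda_circ n" for x
        by (rule alt_gapv[OF Lambda_circ_D(1)[OF that]]) (simp_all add: diff_divide_distrib)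
      then show ?thesis by (simp only: G_def H_def k l)
    qed
    then have "of_nat n * (\<Sum>(a, b, c)\<in>gaps n. H a b c) = 4 * (\<Sum>y\<in>{y\<in>box4 n. decreasing4 y}. G y)"
      by (simp only: sum_decreasing4_gaps sum_gaps_weighted[of H, OF H])
    moreover have "(\<Sum>y\<in>box4 n. G y) = 24 * (\<Sum>y\<in>{y\<in>box4 n. decreasing4 y}. G y)"
    proof (rule sum_box4_antisym)
      fix y \<sigma> assume \<sigma>: "\<sigma> permutes (UNIV :: 4 set)"
      have "(\<chi> i. of_int ((y \<circ> \<sigma>) i) / real n) = permv (\<chi> i. of_int (y i) / real n) \<sigma>"
        by (simp add: permv_def)
      then have "G (y \<circ> \<sigma>) = (of_int (sign \<sigma>) * of_int (sign \<sigma>)) * G y"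
        unfolding G_def by (simp add: alt_permv[OF \<sigma>] del: of_int_sign_mult_self)
      then show "G (y \<circ> \<sigma>) = G y" by simp
    next
      fix y :: "4 \<Rightarrow> int" assume "\<not> inj y"
      then obtain i j where "i \<noteq> j" "y i = y j" by (auto simp: inj_def)
      then show "G y = 0" unfolding G_def by (subst alt_eq_zero[of _ i j]) auto
    qed
    moreover have "(\<Sum>y\<in>box4 n. G y) = (if k = l then 24 * of_nat n ^ 4 else 0)"
      unfolding G_def by (rule sum_box4_alt[OF n k l True])
    ultimately have "of_nat n * (\<Sum>(a, b, c)\<in>gaps n. H a b c) = of_nat n * (if k = l then 4 * of_nat n ^ 3 else 0)"
      by (simp add: power_numeral_reduce split: if_splits)
    then show ?thesis using n by (simp only: mult_cancel_left) auto
  qed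
  then show ?thesis by (simp only: H_def)
qed

text \<open>Consecutive differences of an index are multiples of 4. Their quarters and the zero sum
  determine the index, as the integer vector \<open>4 * gapv a b c\<close>, and the window condition
  becomes \<open>a + b + c < n\<close>.\<close>

lemma sum_Lambda_circ:
  fixes F :: "real^4 \<Rightarrow> complex"
  assumes "n > 0"
  shows "(\<Sum>j\<in>Lambda_circ n. F (\<chi> i. of_int (j $ i) / (4 * real n))) =
    (\<Sum>(a, b, c)\<in>gaps n. F (gapv (a / n) (b / n) (c / n)))"
proof (rule sum.reindex_bij_witness[where
      j = "\<lambda>j. ((j $ 1 - j $ 2) div 4, (j $ 2 - j $ 3) div 4, (j $ 3 - j $ 4) div 4)" and
      i = "\<lambda>(a, b, c). vector [3*a+2*b+c, -a+2*b+c, -a-2*b+c, -a-2*b-3*c] :: int^4"])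
  fix j :: "int^4" assume j: "j \<in> Lambda_circ n"
  define a b c where "a = (j $ 1 - j $ 2) div 4" and "b = (j $ 2 - j $ 3) div 4" and "c = (j $ 3 - j $ 4) div 4"
  have "j $ 1 - j $ 2 = 4 * a" "j $ 2 - j $ 3 = 4 * b" "j $ 3 - j $ 4 = 4 * c"
    using Lambda_circ_D(2)[OF j] by (simp_all add: a_def b_def c_def mod_eq_dvd_iff)
  moreover have "j $ 1 + j $ 2 + j $ 3 + j $ 4 = 0" using Lambda_circ_D(1)[OF j] by (simp add: sum_4)
  ultimately have j': "j $ 1 = 3*a+2*b+c" "j $ 2 = -a+2*b+c" "j $ 3 = -a-2*b+c" "j $ 4 = -a-2*b-3*c"
    by linarith+
  show "(case (a, b, c) of (a, b, c) \<Rightarrow> vector [3*a+2*b+c, -a+2*b+c, -a-2*b+c, -a-2*b-3*c]) = j"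
    using j' by (simp add: vec_eq_iff forall_4 vector_def numeral_eq_Suc)
  show "(a, b, c) \<in> gaps n" using j j' by (auto simp: gaps_def Lambda_circ_def)
  have "gapv (a / n) (b / n) (c / n) = (\<chi> i. of_int (j $ i) / (4 * real n))"
    using assms by (simp add: vec_eq_iff forall_4 j' field_simps)
  then show "(case (a, b, c) of (a, b, c) \<Rightarrow> F (gapv (real_of_int a / n) (real_of_int b / n) (real_of_int c / n))) =
      F (\<chi> i. of_int (j $ i) / (4 * real n))" by simp
next
  fix x assume "x \<in> gaps n"
  then obtain a b c where x: "x = (a, b, c)" and g: "1 \<le> a" "1 \<le> b" "1 \<le> c" "a + b + c < int n"
    by (auto simp: gaps_def)
  define j :: "int^4" where "j = vector [3*a+2*b+c, -a+2*b+c, -a-2*b+c, -a-2*b-3*c]"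
  have j: "j $ 1 = 3*a+2*b+c" "j $ 2 = -a+2*b+c" "j $ 3 = -a-2*b+c" "j $ 4 = -a-2*b-3*c"
    by (simp_all add: j_def vector_def numeral_eq_Suc)
  have "(case x of (a, b, c) \<Rightarrow> vector [3*a+2*b+c, -a+2*b+c, -a-2*b+c, -a-2*b-3*c]) = j"
    by (simp add: x j_def)
  moreover have "((j $ 1 - j $ 2) div 4, (j $ 2 - j $ 3) div 4, (j $ 3 - j $ 4) div 4) = x"
    by (simp add: j x)
  moreover have "j \<in> Lambda_circ n"
  proof -
    have "j $ i mod 4 = j $ 4 mod 4" for i
      using exhaust_4[of i] by (auto simp: j mod_eq_dvd_iff)
    then show ?thesis using g by (auto simp: Lambda_circ_def HH_def sum_4 j)
  qed
  ultimately show "(\<lambda>j::int^4. ((j $ 1 - j $ 2) div 4, (j $ 2 - j $ 3) div 4, (j $ 3 - j $ 4) div 4))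
      (case x of (a, b, c) \<Rightarrow> vector [3*a+2*b+c, -a+2*b+c, -a-2*b+c, -a-2*b-3*c]) = x"
    "(case x of (a, b, c) \<Rightarrow> vector [3*a+2*b+c, -a+2*b+c, -a-2*b+c, -a-2*b-3*c]) \<in> Lambda_circ n"
    by simp_all
qed

section \<open>Riemann sums on the simplex\<close>

definition simplex3 :: "(real^3) set" where
  "simplex3 = {u. 0 \<le> u $ 1 \<and> 0 \<le> u $ 2 \<and> 0 \<le> u $ 3 \<and> u $ 1 + u $ 2 + u $ 3 \<le> 1}"

text \<open>Being the standard simplex gives compactness and the volume
  \<open>1 / 3!\<close>.\<close>

lemma simplex3_eq_hull: "simplex3 = convex hull (insert 0 Basis)"
  unfolding std_simplex
  by (auto simp: simplex3_def Basis_vec_def inner_axis forall_3 sum_3 UNION_singleton_eq_range sum.reindex inj_on_def axis_eq_axis)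

lemma compact_simplex3: "compact simplex3"
  unfolding simplex3_eq_hull by (simp add: finite_imp_compact compact_convex_hull)

lemma measure_simplex3: "measure lebesgue simplex3 = 1 / 6"
proof -
  have "simplex3 \<in> sets borel" using compact_simplex3 by (simp add: borel_compact)
  then have "measure lebesgue simplex3 = measure lborel simplex3" by (simp add: measure_completion)
  also have "\<dots> = 1 / 6" unfolding simplex3_eq_hull by (simp add: content_std_simplex fact_numeral)
  finally show ?thesis .
qed

lemma negligible_simplex3_facet: "negligible {u::real^3. u $ 1 + u $ 2 + u $ 3 = 1}"
proof -
  have "{u::real^3. u $ 1 + u $ 2 + u $ 3 = 1} = {u. (1::real^3) \<bullet> u = 1}"
    by (simp add: inner_vec_def sum_3)
  then show ?thesis by (simp add: negligible_hyperplane)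
qed

lemma negligible_coordinate_plane: "negligible {u::real^'n. u $ i = c}"
proof -
  have "{u::real^'n. u $ i = c} = {u. axis i 1 \<bullet> u = c}" by (simp add: inner_axis')
  then show ?thesis by (simp add: negligible_hyperplane axis_eq_0_iff)
qed

lemma floor_mult_divide_tendsto: "(\<lambda>n. of_int \<lfloor>real n * x\<rfloor> / real n) \<longlonglongrightarrow> x"
proof (rule LIMSEQ_I)
  fix r :: real assume r: "r > 0"
  obtain N :: nat where N: "1 / r < N" using reals_Archimedean2 by blast
  have "norm (of_int \<lfloor>real n * x\<rfloor> / real n - x) < r" if "n \<ge> N" for n
  proof -
    have "real n \<ge> real N" using that by simp
    then have n: "1 / r < n" using N by linarith
    then have n0: "n > 0" using r by (metis divide_nonneg_pos gr0I less_eq_real_def not_less of_nat_0 zero_le_one)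
    have "of_int \<lfloor>real n * x\<rfloor> / real n - x = (of_int \<lfloor>real n * x\<rfloor> - real n * x) / real n"
      using n0 by (simp add: diff_divide_distrib)
    then have "\<bar>of_int \<lfloor>real n * x\<rfloor> / real n - x\<bar> * n = \<bar>of_int \<lfloor>real n * x\<rfloor> - real n * x\<bar>"
      using n0 by simp
    also have "\<dots> \<le> 1" by linarith
    also have "1 < r * n" using n r by (simp add: field_simps)
    finally show ?thesis using n0 by simp
  qed
  then show "\<exists>N. \<forall>n\<ge>N. norm (of_int \<lfloor>real n * x\<rfloor> / real n - x) < r" by blast
qed

text \<open>The half-open cube with prescribed floors lies between an open and a closed box of side
  \<open>1 / n\<close>, which differ by a null set.\<close>

lemma has_integral_grid_cube:
  fixes v :: complex
  assumes "n > 0"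
  shows "((\<lambda>u::real^3. if \<forall>i. \<lfloor>real n * u $ i\<rfloor> = a i then v else 0) has_integral v / of_nat n ^ 3) UNIV"
proof -
  define l where "l = (\<chi> i. of_int (a i) / real n)"
  define r where "r = (\<chi> i. of_int (a i + 1) / real n)"
  have le: "l \<le> r" using assms by (simp add: l_def r_def less_eq_vec_def divide_right_mono)
  have "measure lborel (cbox l r) = (1 / real n) ^ 3"
  proof (subst content_cbox_cart)
    show "cbox l r \<noteq> {}" using le by (auto simp: interval_ne_empty_cart less_eq_vec_def)
  qed (simp add: l_def r_def diff_divide_distrib[symmetric])
  then have 1: "((\<lambda>u. v) has_integral v / of_nat n ^ 3) (cbox l r)"
    using has_integral_const[of v l r] by (simp add: scaleR_conv_of_real power_divide)
  let ?B = "{u::real^3. \<forall>i. \<lfloor>real n * u $ i\<rfloor> = a i}"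
  have B: "\<lfloor>real n * x\<rfloor> = m \<longleftrightarrow> of_int m / real n \<le> x \<and> x < of_int (m + 1) / real n" for x m
    using assms by (auto simp: floor_eq_iff field_simps)
  have 2: "box l r \<subseteq> ?B" "?B \<subseteq> cbox l r"
    unfolding B by (auto simp: mem_box_cart l_def r_def less_imp_le)
  have neg: "negligible (cbox l r - box l r)" by (rule negligible_frontier_interval)
  have "((\<lambda>u. v) has_integral v / of_nat n ^ 3) ?B"
    by (rule has_integral_spike_set_eq[THEN iffD1, OF _ _ 1]; rule negligible_subset[OF neg]) (use 2 in auto)
  then show ?thesis using has_integral_restrict_UNIV[of ?B "\<lambda>_. v"] by simp
qed

text \<open>The Riemann sum is the integral of the step function \<open>s n\<close>, which is
  constant on grid cubes. Off the negligible slanted facet these functions converge pointwise to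
  \<open>h\<close> on the open simplex and to 0 elsewhere, so dominated convergence applies.\<close>

lemma riemann_sum_simplex3:
  fixes h :: "real^3 \<Rightarrow> complex"
  assumes cont: "continuous_on UNIV h"
  shows "(\<lambda>n. (\<Sum>(a, b, c)\<in>gaps n. h (vector [a / n, b / n, c / n])) / of_nat n ^ 3)
    \<longlonglongrightarrow> integral simplex3 h"
proof -
  define fl where "fl n u = (\<chi> i. of_int \<lfloor>real n * u $ i\<rfloor> / real n)" for n and u :: "real^3"
  define s where "s n u = (if (\<lfloor>real n * u $ 1\<rfloor>, \<lfloor>real n * u $ 2\<rfloor>, \<lfloor>real n * u $ 3\<rfloor>) \<in> gaps n
    then h (fl n u) else 0)" for n and u :: "real^3"
  let ?R = "\<lambda>n. (\<Sum>(a, b, c)\<in>gaps n. h (vector [a / n, b / n, c / n])) / of_nat n ^ 3"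
  let ?E = "{u::real^3. u $ 1 + u $ 2 + u $ 3 = 1}"
  let ?I = "{u::real^3. 0 < u $ 1 \<and> 0 < u $ 2 \<and> 0 < u $ 3 \<and> u $ 1 + u $ 2 + u $ 3 < 1}"
  have s_int: "(s n has_integral ?R n) UNIV" for n
  proof (cases "n = 0")
    case True
    \<comment> \<open>For \<open>n = 0\<close> there are no gaps, and the quotient is
      \<open>0 / 0 = 0\<close>.\<close>
    then have "s n = (\<lambda>_. 0)" "gaps n = {}" by (auto simp: s_def gaps_def)
    then show ?thesis by simp
  next
    case False
    let ?t = "\<lambda>(a, b, c) u::real^3. if \<forall>i. \<lfloor>real n * u $ i\<rfloor> = vector [a, b, c] $ i then h (vector [a / n, b / n, c / n]) else 0"
    have "((\<lambda>u. \<Sum>x\<in>gaps n. ?t x u) has_integral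
        (\<Sum>x\<in>gaps n. (case x of (a, b, c) \<Rightarrow> h (vector [a / n, b / n, c / n])) / of_nat n ^ 3)) UNIV"
    proof (rule has_integral_sum[OF finite_gaps])
      fix x :: "int \<times> int \<times> int"
      obtain a b c where x: "x = (a, b, c)" by (cases x)
      show "(?t x has_integral (case x of (a, b, c) \<Rightarrow> h (vector [a / n, b / n, c / n])) / of_nat n ^ 3) UNIV"
        using False has_integral_grid_cube[of n "($) (vector [a, b, c])"] by (simp add: x)
    qed
    moreover have "(\<Sum>x\<in>gaps n. ?t x u) = s n u" for u
    proof -
      let ?x = "(\<lfloor>real n * u $ 1\<rfloor>, \<lfloor>real n * u $ 2\<rfloor>, \<lfloor>real n * u $ 3\<rfloor>)"
      have "vector [of_int \<lfloor>real n * u $ 1\<rfloor> / n, of_int \<lfloor>real n * u $ 2\<rfloor> / n, of_int \<lfloor>real n * u $ 3\<rfloor> / n] = fl n u"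
        by (simp add: fl_def vec_eq_iff forall_3)
      then have "?t x u = (if x = ?x then h (fl n u) else 0)" for x
        by (auto simp: forall_3 split: prod.splits)
      then show ?thesis by (simp add: s_def sum.delta finite_gaps)
    qed
    ultimately show ?thesis by (simp add: sum_divide_distrib case_prod_unfold)
  qed
  have "compact (h ` cbox 0 1)"
    by (intro compact_continuous_image continuous_on_subset[OF cont]) auto
  then obtain M where M: "\<And>u. u \<in> cbox 0 1 \<Longrightarrow> norm (h u) \<le> M"
    by (metis bounded_iff compact_imp_bounded imageI)
  \<comment> \<open>Where the floors form a gap triple, both \<open>u\<close> and its grid point
    \<open>fl n u\<close> lie in the unit cube; elsewhere \<open>s n u = 0\<close>.\<close>
  have bound: "norm (s n u) \<le> (if u \<in> cbox 0 1 then M else 0)" for n u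
  proof (cases "(\<lfloor>real n * u $ 1\<rfloor>, \<lfloor>real n * u $ 2\<rfloor>, \<lfloor>real n * u $ 3\<rfloor>) \<in> gaps n")
    case True
    then have "1 \<le> \<lfloor>real n * u $ 1\<rfloor>" "1 \<le> \<lfloor>real n * u $ 2\<rfloor>" "1 \<le> \<lfloor>real n * u $ 3\<rfloor>"
      "\<lfloor>real n * u $ 1\<rfloor> + \<lfloor>real n * u $ 2\<rfloor> + \<lfloor>real n * u $ 3\<rfloor> < int n"
      by (simp_all only: gaps_def mem_Collect_eq prod.case)
    then have n: "n > 0" and "\<forall>i. 1 \<le> \<lfloor>real n * u $ i\<rfloor> \<and> \<lfloor>real n * u $ i\<rfloor> + 1 \<le> int n"
      unfolding forall_3 by linarith+
    then have fl: "1 \<le> \<lfloor>real n * u $ i\<rfloor> \<and> \<lfloor>real n * u $ i\<rfloor> + 1 \<le> int n" for i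
      by blast
    have "0 \<le> u $ i \<and> u $ i \<le> 1 \<and> of_int \<lfloor>real n * u $ i\<rfloor> / real n \<le> 1" for i
    proof -
      have "0 \<le> real n * u $ i" "real n * u $ i \<le> real n" "real_of_int \<lfloor>real n * u $ i\<rfloor> \<le> real n"
        using fl[of i] by linarith+
      then show ?thesis using n by (auto simp: zero_le_mult_iff)
    qed
    then have "u \<in> cbox 0 1" "fl n u \<in> cbox 0 1"
      using fl by (auto simp: mem_box_cart fl_def intro!: divide_nonneg_nonneg)
    then show ?thesis using M True by (simp add: s_def)
  next
    case False
    have "0 \<le> M" using order_trans[OF norm_ge_zero M[of 0]] by (simp add: mem_box_cart)
    with False show ?thesis by (simp add: s_def)
  qed
  have dom: "(\<lambda>u::real^3. if u \<in> cbox 0 1 then M else 0) integrable_on UNIV"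
    by (simp add: integrable_restrict_UNIV integrable_const)
  have lim: "(\<lambda>n. s n u) \<longlonglongrightarrow> (if u \<in> ?I then h u else 0)" if "u \<in> - ?E" for u
  proof (cases "u \<in> ?I")
    case True
    have "(\<lambda>n. fl n u) \<longlonglongrightarrow> u"
      unfolding fl_def by (rule vec_tendstoI) (simp add: floor_mult_divide_tendsto)
    then have "(\<lambda>n. h (fl n u)) \<longlonglongrightarrow> h u"
      using cont by (auto intro: continuous_on_tendsto_compose)
    moreover have "eventually (\<lambda>n. s n u = h (fl n u)) sequentially"
    proof -
      have ev: "eventually (\<lambda>n. 1 \<le> \<lfloor>real n * u $ i\<rfloor>) sequentially" if "0 < u $ i" for i
      proof -
        have "eventually (\<lambda>n. 1 / u $ i \<le> real n) sequentially"
          by (rule eventually_compose_filterlim[OF eventually_ge_at_top filterlim_real_sequentially])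
        then show ?thesis
          by (rule eventually_mono) (use that in \<open>simp add: field_simps le_floor_iff\<close>)
      qed
      have "0 < u $ 1" "0 < u $ 2" "0 < u $ 3" and lt: "u $ 1 + u $ 2 + u $ 3 < 1"
        using True by auto
      then have "eventually (\<lambda>n. 1 \<le> \<lfloor>real n * u $ 1\<rfloor> \<and> 1 \<le> \<lfloor>real n * u $ 2\<rfloor> \<and> 1 \<le> \<lfloor>real n * u $ 3\<rfloor>) sequentially"
        using ev by (intro eventually_conj)
      then show ?thesis using eventually_gt_at_top[of "0::nat"]
      proof eventually_elim
        case (elim n)
        then have "real n * (u $ 1 + u $ 2 + u $ 3) < real n * 1"
          using lt by (intro mult_strict_left_mono) auto
        then have "real n * u $ 1 + real n * u $ 2 + real n * u $ 3 < n" by (simp add: algebra_simps)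
        then have "\<lfloor>real n * u $ 1\<rfloor> + \<lfloor>real n * u $ 2\<rfloor> + \<lfloor>real n * u $ 3\<rfloor> < int n" by linarith
        with elim show ?case by (auto simp: s_def gaps_def)
      qed
    qed
    ultimately have "(\<lambda>n. s n u) \<longlonglongrightarrow> h u" by (simp add: tendsto_cong)
    then show ?thesis by (simp only: if_P[OF True])
  next
    case False
    have "eventually (\<lambda>n. s n u = 0) sequentially"
    proof (cases "\<exists>i. u $ i \<le> 0")
      case True
      then obtain i where i: "u $ i \<le> 0" by blast
      have "s n u = 0" for n
      proof -
        have "real n * u $ i \<le> 0" using i by (simp add: mult_nonneg_nonpos)
        then have "\<not> 1 \<le> \<lfloor>real n * u $ i\<rfloor>" by linarith
        then show ?thesis using exhaust_3[of i] by (auto simp: s_def gaps_def)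
      qed
      then show ?thesis by simp
    next
      case pos: False
      then have gt: "u $ 1 + u $ 2 + u $ 3 > 1" using False that by (auto simp: not_le)
      \<comment> \<open>Each floor loses less than 1, so the three floors still add up to at least
        \<open>n\<close> once \<open>n\<close> times the excess over 1 reaches 3.\<close>
      have "eventually (\<lambda>n. 3 / (u $ 1 + u $ 2 + u $ 3 - 1) \<le> real n) sequentially"
        by (rule eventually_compose_filterlim[OF eventually_ge_at_top filterlim_real_sequentially])
      then show ?thesis
      proof eventually_elim
        case (elim n)
        then have "3 \<le> real n * (u $ 1 + u $ 2 + u $ 3 - 1)" using gt by (simp add: field_simps)
        then have "real n + 3 \<le> real n * u $ 1 + real n * u $ 2 + real n * u $ 3" by (simp add: algebra_simps)
        then have "\<lfloor>real n * u $ 1\<rfloor> + \<lfloor>real n * u $ 2\<rfloor> + \<lfloor>real n * u $ 3\<rfloor> \<ge> int n" by linarith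
        then show ?case by (simp add: s_def gaps_def)
      qed
    qed
    then have "(\<lambda>n. s n u) \<longlonglongrightarrow> 0" by (rule tendsto_eventually)
    then show ?thesis by (simp only: if_not_P[OF False])
  qed
  have negE: "negligible ?E" by (rule negligible_simplex3_facet)
  have drop: "integral (- ?E) f = integral UNIV f" "f integrable_on UNIV \<Longrightarrow> f integrable_on - ?E"
    for f :: "real^3 \<Rightarrow> 'b::euclidean_space"
  proof -
    show "integral (- ?E) f = integral UNIV f"
      by (rule integral_spike_set; rule negligible_subset[OF negE]) auto
    show "f integrable_on UNIV \<Longrightarrow> f integrable_on - ?E"
      by (erule integrable_spike_set; rule negligible_subset[OF negE]) auto
  qed
  have "(\<lambda>n. integral (- ?E) (s n)) \<longlonglongrightarrow> integral (- ?E) (\<lambda>u. if u \<in> ?I then h u else 0)"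
    by (rule dominated_convergence(2)[OF _ drop(2)[OF dom] bound lim])
       (use s_int in \<open>auto intro!: drop(2)\<close>)
  moreover have "integral (- ?E) (s n) = ?R n" for n
    using s_int[of n] by (simp add: drop(1) integral_unique)
  moreover have "integral (- ?E) (\<lambda>u. if u \<in> ?I then h u else 0) = integral simplex3 h"
  proof -
    have "integral (- ?E) (\<lambda>u. if u \<in> ?I then h u else 0) = integral ?I h"
      unfolding drop(1) by (rule integral_restrict_UNIV)
    also have "\<dots> = integral simplex3 h"
    proof (rule integral_spike_set)
      have "negligible (?E \<union> ({u. u $ 1 = 0} \<union> ({u. u $ 2 = 0} \<union> {u. u $ 3 = 0})))"
        by (intro negligible_Un negE negligible_coordinate_plane)
      then show "negligible {x \<in> simplex3 - ?I. h x \<noteq> 0}"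
        by (rule negligible_subset) (auto simp: simplex3_def)
      show "negligible {x \<in> ?I - simplex3. h x \<noteq> 0}"
        by (rule negligible_subset[of "{}"]) (auto simp: simplex3_def)
    qed
    finally show ?thesis .
  qed
  ultimately show ?thesis by simp
qed

section \<open>Passage to the limit\<close>

lemma continuous_imp_absolutely_integrable_on_compact:
  fixes f :: "'a::euclidean_space \<Rightarrow> 'b::euclidean_space"
  assumes "compact S" "continuous_on S f"
  shows "f absolutely_integrable_on S"
  using borel_integrable_compact[OF assms] unfolding set_integrable_def
  by (subst integrable_completion) (auto dest: borel_measurable_integrable)

text \<open>The linear change of variables is applied to vector-valued functions:
  \<open>\<phi>\<close> identifies the complex numbers with \<open>real^2\<close> and, being bounded
  linear, commutes with the integral.\<close>

lemma integral_linear_image_complex: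
  fixes f :: "real^'m::{finite,wellorder} \<Rightarrow> complex"
  assumes g: "linear g" and S: "compact S" and f: "continuous_on UNIV f"
  shows "integral (g ` S) f = \<bar>det (matrix g)\<bar> *\<^sub>R integral S (f \<circ> g)"
proof -
  define \<phi> :: "complex \<Rightarrow> real^2" where "\<phi> z = vector [Re z, Im z]" for z
  have \<phi>_nth [simp]: "\<phi> z $ 1 = Re z" "\<phi> z $ 2 = Im z" for z by (simp_all add: \<phi>_def)
  have lin: "linear \<phi>" by (rule linearI) (simp_all add: vec_eq_iff forall_2)
  then have bl: "bounded_linear \<phi>" by (simp add: linear_conv_bounded_linear)
  have cg: "continuous_on A g" for A using g by (simp add: linear_continuous_on linear_conv_bounded_linear)
  have gS: "compact (g ` S)" using S cg by (rule compact_continuous_image[rotated])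
  have fg: "continuous_on S (f \<circ> g)"
    by (rule continuous_on_compose[OF cg continuous_on_subset[OF f]]) simp
  have 1: "f integrable_on g ` S"
    using continuous_imp_absolutely_integrable_on_compact[OF gS continuous_on_subset[OF f]]
    by (simp add: absolutely_integrable_on_def)
  have 2: "(f \<circ> g) integrable_on S"
    using continuous_imp_absolutely_integrable_on_compact[OF S fg]
    by (simp add: absolutely_integrable_on_def)
  have "\<phi> (integral (g ` S) f) = integral (g ` S) (\<phi> \<circ> f)"
    by (rule integral_linear[OF 1 bl, symmetric])
  also have "\<dots> = \<bar>det (matrix g)\<bar> *\<^sub>R integral S ((\<phi> \<circ> f) \<circ> g)"
  proof (rule integral_change_of_variables_linear[OF g], rule disjI1)
    show "\<phi> \<circ> f absolutely_integrable_on g ` S"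
      by (rule continuous_imp_absolutely_integrable_on_compact[OF gS])
        (intro continuous_on_compose continuous_on_subset[OF f] linear_continuous_on bl, simp)
  qed
  also have "integral S ((\<phi> \<circ> f) \<circ> g) = \<phi> (integral S (f \<circ> g))"
    using integral_linear[OF 2 bl] by (simp add: o_assoc)
  also have "\<bar>det (matrix g)\<bar> *\<^sub>R \<dots> = \<phi> (\<bar>det (matrix g)\<bar> *\<^sub>R integral S (f \<circ> g))"
    by (simp add: linear_cmul[OF lin])
  finally show ?thesis by (simp add: vec_eq_iff forall_2 complex_eq_iff)
qed

text \<open>The first three coordinates of \<open>gapv\<close>; \<open>Hpar\<close> supplies the
  fourth.\<close>

definition gapmap :: "real^3 \<Rightarrow> real^3" where
  "gapmap u = vector [(3 * u $ 1 + 2 * u $ 2 + u $ 3) / 4, (- u $ 1 + 2 * u $ 2 + u $ 3) / 4,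
     (- u $ 1 - 2 * u $ 2 + u $ 3) / 4]"

lemma linear_gapmap: "linear gapmap"
  by (rule linearI) (simp_all add: gapmap_def vec_eq_iff forall_3 field_simps)

lemma Hpar_nth [simp]:
  "Hpar x $ 1 = x $ 1" "Hpar x $ 2 = x $ 2" "Hpar x $ 3 = x $ 3" "Hpar x $ 4 = - (x $ 1 + x $ 2 + x $ 3)"
  by (simp_all add: Hpar_def vector_def numeral_eq_Suc)

lemma linear_Hpar: "linear Hpar"
  by (rule linearI) (simp_all add: vec_eq_iff forall_4 algebra_simps del: One_nat_def)

lemma Hpar_gapmap: "Hpar (gapmap u) = gapv (u $ 1) (u $ 2) (u $ 3)"
  by (simp add: vec_eq_iff forall_4 gapmap_def field_simps)

text \<open>An explicit right inverse: its third entry is \<open>x $ 3\<close> minus the fourth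
  coordinate of \<open>Hpar x\<close>.\<close>

lemma gapmap_differences:
  "gapmap (vector [x $ 1 - x $ 2, x $ 2 - x $ 3, x $ 1 + x $ 2 + 2 * x $ 3]) = x"
  by (simp add: gapmap_def vec_eq_iff forall_3 field_simps)

lemma det_gapmap_nonzero: "det (matrix gapmap) \<noteq> 0"
proof -
  have "surj gapmap" by (rule surjI) (rule gapmap_differences)
  then have "inj gapmap" using linear_gapmap linear_surj_imp_inj by blast
  then show ?thesis using det_nz_iff_inj linear_gapmap by blast
qed

text \<open>In gap coordinates the alcove requires nonnegative gaps whose sum, the difference
  \<open>t1 - t4\<close>, is at most 1.\<close>

lemma gapmap_image_simplex3: "gapmap ` simplex3 = {x. Hpar x \<in> triangle_H}"
proof (intro equalityI subsetI)
  fix x assume "x \<in> {x. Hpar x \<in> triangle_H}"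
  then have "vector [x $ 1 - x $ 2, x $ 2 - x $ 3, x $ 1 + x $ 2 + 2 * x $ 3] \<in> simplex3"
    by (auto simp: simplex3_def triangle_H_def)
  then show "x \<in> gapmap ` simplex3" using gapmap_differences by (metis imageI)
next
  fix x assume "x \<in> gapmap ` simplex3"
  then show "x \<in> {x. Hpar x \<in> triangle_H}"
    by (auto simp: simplex3_def triangle_H_def sum_4 Hpar_gapmap simp del: Hpar_nth)
      (simp_all add: field_simps)
qed

text \<open>The Jacobian of \<open>gapmap\<close> occurs in the integral and in the volume and
  cancels; 6 is the reciprocal volume of \<open>simplex3\<close>.\<close>

lemma ip_triangle_eq_simplex3:
  assumes "continuous_on UNIV f" "continuous_on UNIV g"
  shows "ip_triangle f g = 6 * integral simplex3 (\<lambda>u. f (Hpar (gapmap u)) * cnj (g (Hpar (gapmap u))))"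
proof -
  have cont_Hpar: "continuous_on UNIV Hpar"
    using linear_Hpar by (simp add: linear_continuous_on linear_conv_bounded_linear)
  have "continuous_on UNIV (\<lambda>x. f (Hpar x) * cnj (g (Hpar x)))"
    by (intro continuous_intros continuous_on_compose2[OF assms(1) cont_Hpar]
        continuous_on_compose2[OF assms(2) cont_Hpar]) auto
  then have "integral {x. Hpar x \<in> triangle_H} (\<lambda>x. f (Hpar x) * cnj (g (Hpar x))) =
      \<bar>det (matrix gapmap)\<bar> *\<^sub>R integral simplex3 (\<lambda>u. f (Hpar (gapmap u)) * cnj (g (Hpar (gapmap u))))"
    using integral_linear_image_complex[OF linear_gapmap compact_simplex3]
    by (simp add: gapmap_image_simplex3[symmetric] o_def)
  moreover have M: "measure lebesgue {x. Hpar x \<in> triangle_H} = \<bar>det (matrix gapmap)\<bar> / 6"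
    unfolding gapmap_image_simplex3[symmetric]
    by (subst measure_linear_image[OF linear_gapmap])
       (simp_all add: measure_simplex3 lmeasurable_compact compact_simplex3)
  ultimately show ?thesis
    using det_gapmap_nonzero unfolding ip_triangle_def M by (simp add: scaleR_conv_of_real)
qed

lemma continuous_on_TS: "continuous_on UNIV (TS k)"
  unfolding TS_def phi_def permv_def by (auto intro!: continuous_intros)

text \<open>The factor \<open>6 / n ^ 3\<close> is the volume of a grid cube divided by that of the
  simplex, so for \<open>n > 0\<close> the discrete product is a normalised Riemann sum.\<close>

lemma ip_disc_tendsto:
  assumes "continuous_on UNIV f" "continuous_on UNIV g"
  shows "(\<lambda>n. ip_disc n f g) \<longlonglongrightarrow> ip_triangle f g"
proof -
  let ?h = "\<lambda>u. f (Hpar (gapmap u)) * cnj (g (Hpar (gapmap u)))"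
  have "linear (\<lambda>u. Hpar (gapmap u))"
    using linear_compose[OF linear_gapmap linear_Hpar] by (simp add: o_def)
  then have cont: "continuous_on UNIV (\<lambda>u. Hpar (gapmap u))"
    by (simp add: linear_continuous_on linear_conv_bounded_linear)
  have "continuous_on UNIV ?h"
    by (intro continuous_intros continuous_on_compose2[OF assms(1) cont]
        continuous_on_compose2[OF assms(2) cont]) auto
  then have "(\<lambda>n. 6 * ((\<Sum>(a, b, c)\<in>gaps n. ?h (vector [a / n, b / n, c / n])) / of_nat n ^ 3))
      \<longlonglongrightarrow> 6 * integral simplex3 ?h"
    by (intro tendsto_intros riemann_sum_simplex3)
  moreover have "eventually (\<lambda>n. 6 * ((\<Sum>(a, b, c)\<in>gaps n. ?h (vector [a / n, b / n, c / n])) / of_nat n ^ 3) =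
      ip_disc n f g) sequentially"
    using eventually_gt_at_top[of 0]
  proof eventually_elim
    case (elim n)
    then show ?case
      using sum_Lambda_circ[OF elim, of "\<lambda>t. f t * cnj (g t)"]
      by (simp add: ip_disc_def Hpar_gapmap)
  qed
  ultimately show ?thesis
    unfolding ip_triangle_eq_simplex3[OF assms] by (rule Lim_transform_eventually)
qed

section \<open>Independence of the order of the discrete product\<close>

lemma Lambda_circ_mono: "n \<le> m \<Longrightarrow> Lambda_circ n \<subseteq> Lambda_circ m"
  by (auto simp: Lambda_circ_def)

text \<open>The powers of \<open>n\<close> cancel:
  \<open>(6 / n ^ 3) * (1 / 24 ^ 2) * (4 * n ^ 3) = 1 / 24\<close>.\<close>

lemma ip_disc_TS:
  assumes n: "n > 0" and k: "k \<in> Lambda_circ n" and l: "l \<in> Lambda_circ n"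
  shows "ip_disc n (TS k) (TS l) = (if k = l then 1 / 24 else 0)"
proof -
  have "(\<Sum>j\<in>Lambda_circ n. TS k (\<chi> i. of_int (j $ i) / (4 * real n)) * cnj (TS l (\<chi> i. of_int (j $ i) / (4 * real n)))) =
      (\<Sum>(a, b, c)\<in>gaps n. 1 / 576 * (alt k (gapv (a / n) (b / n) (c / n)) * cnj (alt l (gapv (a / n) (b / n) (c / n)))))"
    using sum_Lambda_circ[OF n, of "\<lambda>t. TS k t * cnj (TS l t)"] by (simp add: TS_eq_alt)
  also have "\<dots> = 1 / 576 * (if k = l then 4 * of_nat n ^ 3 else 0)"
    using sum_gaps_alt[OF n k l] by (simp only: sum_distrib_left[symmetric] case_prod_unfold)
  finally have S: "(\<Sum>j\<in>Lambda_circ n. TS k (\<chi> i. of_int (j $ i) / (4 * real n)) *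
      cnj (TS l (\<chi> i. of_int (j $ i) / (4 * real n)))) = 1 / 576 * (if k = l then 4 * of_nat n ^ 3 else 0)" .
  show ?thesis unfolding ip_disc_def S using n by simp
qed

lemma ip_disc_sum:
  "ip_disc n (\<lambda>t. \<Sum>k\<in>A. c k * F k t) (\<lambda>t. \<Sum>l\<in>B. d l * F l t) =
    (\<Sum>k\<in>A. \<Sum>l\<in>B. c k * cnj (d l) * ip_disc n (F k) (F l))"
proof -
  define x :: "int^4 \<Rightarrow> real^4" where "x j = (\<chi> i. of_int (j $ i) / (4 * real n))" for j
  have "(\<Sum>k\<in>A. c k * F k t) * cnj (\<Sum>l\<in>B. d l * F l t) =
      (\<Sum>k\<in>A. \<Sum>l\<in>B. c k * cnj (d l) * (F k t * cnj (F l t)))" for t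
    by (simp add: sum_product mult_ac)
  then have "(\<Sum>j\<in>Lambda_circ n. (\<Sum>k\<in>A. c k * F k (x j)) * cnj (\<Sum>l\<in>B. d l * F l (x j))) =
      (\<Sum>k\<in>A. \<Sum>l\<in>B. \<Sum>j\<in>Lambda_circ n. c k * cnj (d l) * (F k (x j) * cnj (F l (x j))))"
    by (simp only: sum.swap[where A = "Lambda_circ n"])
  then show ?thesis
    unfolding ip_disc_def x_def by (simp add: sum_distrib_left mult_ac)
qed

theorem theorem4p5:
  fixes n :: nat and f g :: "real^4 \<Rightarrow> complex"
  assumes "n \<ge> 1" and "f \<in> TS_space n" and "g \<in> TS_space n"
  shows "ip_disc n f g = ip_triangle f g"
proof -
  obtain c d where f: "f = (\<lambda>t. \<Sum>k\<in>Lambda_circ n. c k * TS k t)"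
    and g: "g = (\<lambda>t. \<Sum>k\<in>Lambda_circ n. d k * TS k t)"
    using assms(2,3) by (auto simp: TS_space_def)
  \<comment> \<open>The expansions over \<open>Lambda_circ n\<close> are kept fixed. Their indices
    also lie in \<open>Lambda_circ m\<close>, so order \<open>m\<close> gives the same value for
    each pair of basis functions.\<close>
  have "ip_disc m f g = ip_disc n f g" if "m \<ge> n" for m
    unfolding f g ip_disc_sum
    using Lambda_circ_mono[OF that] that assms(1) by (intro sum.cong refl) (simp add: ip_disc_TS subset_iff)
  then have "eventually (\<lambda>m. ip_disc m f g = ip_disc n f g) sequentially"
    using eventually_sequentially by blast
  then have "(\<lambda>m. ip_disc m f g) \<longlonglongrightarrow> ip_disc n f g"
    by (rule tendsto_eventually)
  moreover have "(\<lambda>m. ip_disc m f g) \<longlonglongrightarrow> ip_triangle f g"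
    by (rule ip_disc_tendsto) (auto simp: f g intro!: continuous_intros continuous_on_TS)
  ultimately show ?thesis by (rule LIMSEQ_unique)
qed

end
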